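(* Let $q\in Q$ and let $F:\mathsf C\to\mathsf D$, $G:\mathsf D\to\mathsf C$ be $\mathsf Q$-functors forming a $q$-fuzzy $\mathsf Q$-adjunction $F\dashv_q G$. Then for every set $\mathsf S$ and functions $S:\mathsf S\to\mathrm{ob}(\mathsf C)$, $W:\mathsf S\to Q$, whenever the weighted joins below exist, $$F\bigvee^W S\approx_{q^2}\bigvee^W FS,$$ and dually, for every $S:\mathsf S\to\mathrm{ob}(\mathsf D)$ and $W:\mathsf S\to Q$, whenever the weighted meets below exist, $$G\bigwedge^W S\approx_{q^2}\bigwedge^W GS.$$
   Context: Throughout, $\mathsf Q=(Q,\preceq,\cdot,1)$ is a commutative, unital, semicartesian quantale: $(Q,\preceq)$ is a complete lattice, $\cdot$ is an associative commutative operation with unit $1$ that distributes over arbitrary joins in each variable, and $p\cdot q\preceq p\wedge q$ (so $1=\top$). $[p,q]:=\bigvee\{r: p\cdot r\preceq q\}$, and $q^2=q\cdot q$. A (small) $\mathsf Q$-category $\mathsf C$ is a set $\mathrm{ob}(\mathsf C)$ with elements $\hom_{\mathsf C}(x,y)\in Q$ such that $\hom_{\mathsf C}(x,x)=1$ and $\hom_{\mathsf C}(x,y)\cdot\hom_{\mathsf C}(y,z)\preceq\hom_{\mathsf C}(x,z)$. A $\mathsf Q$-functor is a function $F$ on objects with $\hom_{\mathsf C}(x,y)\preceq\hom_{\mathsf D}(Fx,Fy)$. $x\preceq_q y$ means $\hom(x,y)\succeq q$; $x\approx_q y$ means $x\preceq_q y$ and $y\preceq_q x$. $Q$ itself is a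 $\mathsf Q$-category with $\hom(p,q)=[p,q]$. The weighted meet $\bigwedge^W S$ is an object with $\hom(x,\bigwedge^W S)=\bigwedge_{c\in\mathsf S}[W(c),\hom(x,S(c))]$ for all $x$; the weighted join $\bigvee^W S$ is an object with $\hom(\bigvee^W S,x)=\bigwedge_{c\in\mathsf S}[W(c),\hom(S(c),x)]$ for all $x$. $FS$ denotes the composite function $c\mapsto F(S(c))$. $\mathsf Q$-functors $F:\mathsf C\to\mathsf D$ and $G:\mathsf D\to\mathsf C$ form a $q$-fuzzy $\mathsf Q$-adjunction, $F\dashv_q G$, if $\hom_{\mathsf D}(Fx,y)\approx_q\hom_{\mathsf C}(x,Gy)$ (in $Q$) for all $x\in\mathsf C$, $y\in\mathsf D$. *)

theory Defs
  imports Main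
begin

text \<open>Commutativity of multiplication makes distributivity in one variable sufficient. The join over
  the empty set is included, so bot is absorbing.\<close>

class semicartesian_quantale = complete_lattice + comm_monoid_mult +
  assumes mult_Sup_distrib: "p * Sup A = (SUP r\<in>A. p * r)"
    and mult_le_inf: "p * r \<le> inf p r"

definition residual :: "'q::semicartesian_quantale \<Rightarrow> 'q \<Rightarrow> 'q" where
  "residual p q = Sup {r. p * r \<le> q}"

lemma one_eq_top: "(1::'q::semicartesian_quantale) = top"
  using mult_le_inf[of 1 "top::'q"] by (simp add: top.extremum_unique)

lemma mult_mono_right:
  fixes p r s :: "'q::semicartesian_quantale"
  assumes "r \<le> s"
  shows "p * r \<le> p * s"
proof -
  have "p * s = (SUP t\<in>{r, s}. p * t)"
    using mult_Sup_distrib[of p "{r, s}"] assms by (simp add: sup_absorb2)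
  then show ?thesis
    by (simp add: le_iff_sup)
qed

lemma residual_galois:
  fixes p q r :: "'q::semicartesian_quantale"
  shows "p * r \<le> q \<longleftrightarrow> r \<le> residual p q"
proof
  assume "p * r \<le> q"
  then show "r \<le> residual p q"
    by (auto simp: residual_def intro: Sup_upper)
next
  assume "r \<le> residual p q"
  then have "p * r \<le> p * residual p q"
    by (rule mult_mono_right)
  also have "\<dots> \<le> q"
    by (auto simp: residual_def mult_Sup_distrib intro: SUP_least)
  finally show "p * r \<le> q" .
qed

text \<open>The values of the hom function outside the set of objects are irrelevant.\<close>

record ('a, 'q) qcat =
  ob :: "'a set"
  hom :: "'a \<Rightarrow> 'a \<Rightarrow> 'q"

locale qcategory =
  fixes C :: "('a, 'q::semicartesian_quantale) qcat"
  assumes hom_refl: "x \<in> ob C \<Longrightarrow> hom C x x = 1"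
    and hom_trans: "\<lbrakk>x \<in> ob C; y \<in> ob C; z \<in> ob C\<rbrakk> \<Longrightarrow> hom C x y * hom C y z \<le> hom C x z"

locale qfunctor = source: qcategory C + target: qcategory D
  for C :: "('a, 'q::semicartesian_quantale) qcat" and D :: "('b, 'q) qcat" +
  fixes F :: "'a \<Rightarrow> 'b"
  assumes map_ob: "x \<in> ob C \<Longrightarrow> F x \<in> ob D"
    and map_hom: "\<lbrakk>x \<in> ob C; y \<in> ob C\<rbrakk> \<Longrightarrow> hom C x y \<le> hom D (F x) (F y)"

definition fuzzy_le :: "('a, 'q::semicartesian_quantale) qcat \<Rightarrow> 'q \<Rightarrow> 'a \<Rightarrow> 'a \<Rightarrow> bool" where
  "fuzzy_le C q x y \<longleftrightarrow> q \<le> hom C x y"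

definition fuzzy_eq :: "('a, 'q::semicartesian_quantale) qcat \<Rightarrow> 'q \<Rightarrow> 'a \<Rightarrow> 'a \<Rightarrow> bool" where
  "fuzzy_eq C q x y \<longleftrightarrow> fuzzy_le C q x y \<and> fuzzy_le C q y x"

definition quantale_cat :: "('q, 'q::semicartesian_quantale) qcat" where
  "quantale_cat = \<lparr>ob = UNIV, hom = residual\<rparr>"

lemma qcategory_quantale_cat: "qcategory (quantale_cat :: ('q, 'q::semicartesian_quantale) qcat)"
proof
  fix x y z :: 'q
  have "1 \<le> residual x x"
    by (simp flip: residual_galois)
  then show "hom quantale_cat x x = 1"
    by (simp add: quantale_cat_def one_eq_top top.extremum_unique)
  have "x * residual x y * residual y z \<le> y * residual y z"
    using mult_mono_right[of "x * residual x y" y "residual y z"]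
    by (simp add: residual_galois mult.commute)
  also have "\<dots> \<le> z"
    by (simp add: residual_galois)
  finally show "hom quantale_cat x y * hom quantale_cat y z \<le> hom quantale_cat x z"
    by (simp add: quantale_cat_def mult.assoc flip: residual_galois)
qed

text \<open>Weighted meets and joins need not exist and are unique only up to isomorphism, so being one is
  a predicate on objects rather than an operation. The diagram \<open>S\<close> and the weight \<open>W\<close> are functions
  on the index set \<open>I\<close>.\<close>

definition is_weighted_meet ::
    "('a, 'q::semicartesian_quantale) qcat \<Rightarrow> 'i set \<Rightarrow> ('i \<Rightarrow> 'q) \<Rightarrow> ('i \<Rightarrow> 'a) \<Rightarrow> 'a \<Rightarrow> bool" where
  "is_weighted_meet C I W S m \<longleftrightarrow> m \<in> ob C \<and>
     (\<forall>x\<in>ob C. hom C x m = (INF c\<in>I. residual (W c) (hom C x (S c))))"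

definition is_weighted_join ::
    "('a, 'q::semicartesian_quantale) qcat \<Rightarrow> 'i set \<Rightarrow> ('i \<Rightarrow> 'q) \<Rightarrow> ('i \<Rightarrow> 'a) \<Rightarrow> 'a \<Rightarrow> bool" where
  "is_weighted_join C I W S j \<longleftrightarrow> j \<in> ob C \<and>
     (\<forall>x\<in>ob C. hom C j x = (INF c\<in>I. residual (W c) (hom C (S c) x)))"

locale fuzzy_adjunction = left: qfunctor C D F + right: qfunctor D C G
  for C :: "('a, 'q::semicartesian_quantale) qcat" and D :: "('b, 'q) qcat"
    and q :: 'q and F :: "'a \<Rightarrow> 'b" and G :: "'b \<Rightarrow> 'a" +
  assumes hom_fuzzy_eq:
    "\<lbrakk>x \<in> ob C; y \<in> ob D\<rbrakk> \<Longrightarrow> fuzzy_eq quantale_cat q (hom D (F x) y) (hom C x (G y))"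

end

theory Submission
  imports Defs
begin

text \<open>The homs out of \<open>F j\<close> and out of \<open>k\<close> agree up to \<open>q\<^sup>2\<close>: one factor \<open>q\<close> is spent on transposing
  \<open>hom (F j) y\<close> to \<open>hom j (G y)\<close>, and another on transposing back inside the infimum that expresses
  the latter through the diagram. Taking \<open>y\<close> to be \<open>F j\<close> and \<open>k\<close>, where one of the two homs is the
  unit, gives the claim for joins.\<close>

text \<open>This is functoriality of \<open>residual w\<close> on the quantale: a degree
  \<open>q\<close> to which \<open>a\<close> lies below \<open>b\<close> is kept. Multiply the
  evaluation inequality \<open>w * residual w a \<le> a\<close> by \<open>q\<close> and transpose
  \<open>w\<close> back.\<close>

lemma mult_residual_mono:
  fixes q w a b :: "'q::semicartesian_quantale"
  assumes "q * a \<le> b"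
  shows "q * residual w a \<le> residual w b"
proof -
  have "w * residual w a \<le> a"
    by (simp add: residual_galois)
  then have "q * (w * residual w a) \<le> q * a"
    by (rule mult_mono_right)
  then have "w * (q * residual w a) \<le> b"
    using assms by (simp add: mult.left_commute)
  then show ?thesis
    by (simp add: residual_galois)
qed

text \<open>The factor \<open>q\<close> multiplies the infimum as a whole, so comparing all indices
  costs a single \<open>q\<close>, however large \<open>I\<close> is.\<close>

lemma mult_INF_residual_mono:
  fixes q :: "'q::semicartesian_quantale"
  assumes "\<And>c. c \<in> I \<Longrightarrow> q * f c \<le> g c"
  shows "q * (INF c\<in>I. residual (W c) (f c)) \<le> (INF c\<in>I. residual (W c) (g c))"
proof (rule INF_greatest)
  fix c assume c: "c \<in> I"
  have "q * (INF c\<in>I. residual (W c) (f c)) \<le> q * residual (W c) (f c)"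
    by (intro mult_mono_right INF_lower c)
  also have "\<dots> \<le> residual (W c) (g c)"
    by (intro mult_residual_mono assms c)
  finally show "q * (INF c\<in>I. residual (W c) (f c)) \<le> residual (W c) (g c)" .
qed

text \<open>This is where the square arises: each of the two chained inequalities loses a factor
  \<open>q\<close>, and \<open>q\<close> need not be idempotent.\<close>

lemma mult_power2_le_trans:
  fixes q a b c :: "'q::semicartesian_quantale"
  assumes "q * a \<le> b" "q * b \<le> c"
  shows "q\<^sup>2 * a \<le> c"
  using mult_mono_right[OF assms(1), of q] assms(2)
  by (simp add: power2_eq_square mult.assoc)

context fuzzy_adjunction
begin

text \<open>Residuation turns the fuzzy equality in \<open>quantale_cat\<close> into products, the
  form in which the comparisons can be chained.\<close>

lemma mult_hom_le_transpose:
  assumes "x \<in> ob C" "y \<in> ob D"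
  shows "q * hom D (F x) y \<le> hom C x (G y)" "q * hom C x (G y) \<le> hom D (F x) y"
  using hom_fuzzy_eq[OF assms]
  by (simp_all add: fuzzy_eq_def fuzzy_le_def quantale_cat_def mult.commute flip: residual_galois)

lemma left_adjoint_weighted_join:
  assumes S: "S ` I \<subseteq> ob C"
    and j: "is_weighted_join C I W S j"
    and k: "is_weighted_join D I W (F \<circ> S) k"
  shows "fuzzy_eq D (q\<^sup>2) (F j) k"
proof -
  have ob: "j \<in> ob C" "k \<in> ob D" "F j \<in> ob D" "\<And>c. c \<in> I \<Longrightarrow> S c \<in> ob C"
    using S j k left.map_ob by (auto simp: is_weighted_join_def)
  \<comment> \<open>The property of \<open>j\<close> is tested only at objects \<open>G y\<close>;
    the two infima then differ termwise by one transposition.\<close>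
  have join: "hom C j (G y) = (INF c\<in>I. residual (W c) (hom C (S c) (G y)))"
    "hom D k y = (INF c\<in>I. residual (W c) (hom D (F (S c)) y))" if "y \<in> ob D" for y
    using j k right.map_ob that by (simp_all add: is_weighted_join_def)
  have "q\<^sup>2 * hom D (F j) y \<le> hom D k y" if "y \<in> ob D" for y
  proof (rule mult_power2_le_trans)
    show "q * hom D (F j) y \<le> hom C j (G y)"
      using ob that by (intro mult_hom_le_transpose)
    show "q * hom C j (G y) \<le> hom D k y"
      unfolding join[OF that]
      using ob that by (intro mult_INF_residual_mono mult_hom_le_transpose)
  qed
  from this[of "F j"] have "q\<^sup>2 \<le> hom D k (F j)"
    using ob by (simp add: left.target.hom_refl)
  moreover have "q\<^sup>2 * hom D k y \<le> hom D (F j) y" if "y \<in> ob D" for y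
  proof (rule mult_power2_le_trans)
    show "q * hom D k y \<le> hom C j (G y)"
      unfolding join[OF that]
      using ob that by (intro mult_INF_residual_mono mult_hom_le_transpose)
    show "q * hom C j (G y) \<le> hom D (F j) y"
      using ob that by (intro mult_hom_le_transpose)
  qed
  from this[of k] have "q\<^sup>2 \<le> hom D (F j) k"
    using ob by (simp add: left.target.hom_refl)
  ultimately show ?thesis
    by (simp add: fuzzy_eq_def fuzzy_le_def)
qed

text \<open>Dually, homs into \<open>G m\<close> and into \<open>n\<close> are compared through
  \<open>hom D (F x) m\<close>, and \<open>x\<close> is then taken to be \<open>G m\<close> and
  \<open>n\<close>.\<close>

lemma right_adjoint_weighted_meet:
  assumes S: "S ` I \<subseteq> ob D"
    and m: "is_weighted_meet D I W S m"
    and n: "is_weighted_meet C I W (G \<circ> S) n"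
  shows "fuzzy_eq C (q\<^sup>2) (G m) n"
proof -
  have ob: "m \<in> ob D" "n \<in> ob C" "G m \<in> ob C" "\<And>c. c \<in> I \<Longrightarrow> S c \<in> ob D"
    using S m n right.map_ob by (auto simp: is_weighted_meet_def)
  \<comment> \<open>Here \<open>m\<close> is tested at objects \<open>F x\<close>, so that
    transposing each term gives the infimum for \<open>n\<close> at \<open>x\<close>.\<close>
  have meet: "hom D (F x) m = (INF c\<in>I. residual (W c) (hom D (F x) (S c)))"
    "hom C x n = (INF c\<in>I. residual (W c) (hom C x (G (S c))))" if "x \<in> ob C" for x
    using m n left.map_ob that by (simp_all add: is_weighted_meet_def)
  have "q\<^sup>2 * hom C x (G m) \<le> hom C x n" if "x \<in> ob C" for x
  proof (rule mult_power2_le_trans)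
    show "q * hom C x (G m) \<le> hom D (F x) m"
      using ob that by (intro mult_hom_le_transpose)
    show "q * hom D (F x) m \<le> hom C x n"
      unfolding meet[OF that]
      using ob that by (intro mult_INF_residual_mono mult_hom_le_transpose)
  qed
  from this[of "G m"] have "q\<^sup>2 \<le> hom C (G m) n"
    using ob by (simp add: left.source.hom_refl)
  moreover have "q\<^sup>2 * hom C x n \<le> hom C x (G m)" if "x \<in> ob C" for x
  proof (rule mult_power2_le_trans)
    show "q * hom C x n \<le> hom D (F x) m"
      unfolding meet[OF that]
      using ob that by (intro mult_INF_residual_mono mult_hom_le_transpose)
    show "q * hom D (F x) m \<le> hom C x (G m)"
      using ob that by (intro mult_hom_le_transpose)
  qed
  from this[of n] have "q\<^sup>2 \<le> hom C n (G m)"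
    using ob by (simp add: left.source.hom_refl)
  ultimately show ?thesis
    by (simp add: fuzzy_eq_def fuzzy_le_def)
qed

end

theorem lemmaA6:
  fixes C :: "('a, 'q::semicartesian_quantale) qcat" and D :: "('b, 'q) qcat"
    and q :: 'q and F :: "'a \<Rightarrow> 'b" and G :: "'b \<Rightarrow> 'a"
  assumes "fuzzy_adjunction C D q F G"
  shows "(\<forall>(I :: 'i set) (S :: 'i \<Rightarrow> 'a) (W :: 'i \<Rightarrow> 'q) j k.
            S ` I \<subseteq> ob C \<longrightarrow> is_weighted_join C I W S j \<longrightarrow> is_weighted_join D I W (F \<circ> S) k \<longrightarrow>
              fuzzy_eq D (q\<^sup>2) (F j) k)
       \<and> (\<forall>(I :: 'j set) (S :: 'j \<Rightarrow> 'b) (W :: 'j \<Rightarrow> 'q) m n.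
            S ` I \<subseteq> ob D \<longrightarrow> is_weighted_meet D I W S m \<longrightarrow> is_weighted_meet C I W (G \<circ> S) n \<longrightarrow>
              fuzzy_eq C (q\<^sup>2) (G m) n)"
  by (intro conjI allI impI fuzzy_adjunction.left_adjoint_weighted_join[OF assms]
      fuzzy_adjunction.right_adjoint_weighted_meet[OF assms])

end
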